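(* Let $m\ge 1$ be an integer, let $s,\ell\ge 0$ be integers, and let $D$ be an integer-valued random variable with $\mathbf{P}(-\ell\le D\le s)=1$. Fix $k\in\mathbb{Z}$ and define a function $G$ of the $\ell+s+1$ real variables $f_{k+\ell},\dots,f_k,\dots,f_{k-s}$ by $$G(f_{k+\ell},\dots,f_{k-s})=f_k-\sum_{j=k-s}^{k-1}(f_{j+1}-f_j)^{m+1}\,\mathbf{P}(D\ge k-j)+\sum_{j=k}^{k+\ell-1}(f_{j+1}-f_j)^{m+1}\,\mathbf{P}(D<k-j).$$ If $\mathbf{P}(|D|>1)>0$, then there is no $\Lambda>0$ such that $G$ is nondecreasing in each argument on the set of $(f_{k+\ell},\dots,f_{k-s})$ satisfying $$0\le f_{j+1}-f_j\le\Lambda\quad\text{for all integers } j\in[k-s,k+\ell-1].$$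
   Context: Empty sums are zero. (The function $G$ arises as the one-step recursion $F^{n+1}_k=G(F^n_{k+\ell},\dots,F^n_{k-s})$ for $F^n_k=\mathbf{P}(X_n<k)$, where $X_n$ is a process in which $X_{n+1}=X_n+D_n$ if $m$ independent copies of $X_n$ all equal $X_n$, and $X_{n+1}=X_n$ otherwise, with $D_n$ i.i.d. copies of $D$; this interpretation is not needed for the statement.) *)

theory Defs
  imports "HOL-Probability.Probability"
begin

text \<open>
  The tuple \<open>(f\<^bsub>k+l\<^esub>, \<dots>, f\<^bsub>k-s\<^esub>)\<close> is represented by a function on the index set
  \<open>{k - s..k + l}\<close> of integers, i.e. by an element of
  \<open>{k - s..k + l} \<rightarrow>\<^sub>E UNIV\<close>.
\<close>

definition G :: "'w measure \<Rightarrow> ('w \<Rightarrow> int) \<Rightarrow> nat \<Rightarrow> nat \<Rightarrow> nat \<Rightarrow> int \<Rightarrow> (int \<Rightarrow> real) \<Rightarrow> real" where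
  "G M D m s l k f =
     f k
     - (\<Sum>j\<in>{k - int s..k - 1}. (f (j + 1) - f j) ^ (m + 1) * \<P>(\<omega> in M. D \<omega> \<ge> k - j))
     + (\<Sum>j\<in>{k..k + int l - 1}. (f (j + 1) - f j) ^ (m + 1) * \<P>(\<omega> in M. D \<omega> < k - j))"

definition increments_bounded :: "nat \<Rightarrow> nat \<Rightarrow> int \<Rightarrow> real \<Rightarrow> (int \<Rightarrow> real) set" where
  "increments_bounded s l k \<Lambda> =
     {f \<in> {k - int s..k + int l} \<rightarrow>\<^sub>E UNIV.
        \<forall>j\<in>{k - int s..k + int l - 1}. 0 \<le> f (j + 1) - f j \<and> f (j + 1) - f j \<le> \<Lambda>}"

text \<open>
  On a set \<open>A\<close> that need not be a product, monotonicity in the \<open>i\<close>-th argument compares any two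
  points of \<open>A\<close> that differ at most in coordinate \<open>i\<close>; the segment joining them is not
  required to lie in \<open>A\<close>.
\<close>

definition nondecreasing_in_each_arg_on ::
    "'i set \<Rightarrow> ('i \<Rightarrow> real) set \<Rightarrow> (('i \<Rightarrow> real) \<Rightarrow> real) \<Rightarrow> bool" where
  "nondecreasing_in_each_arg_on I A F \<longleftrightarrow>
     (\<forall>i\<in>I. \<forall>f\<in>A. mono_on {x. f(i := x) \<in> A} (\<lambda>x. F (f(i := x))))"

end

theory Submission
  imports Defs
begin

text \<open>
  Consider a profile that vanishes to the left of a site \<open>c\<close>, equals \<open>\<Lambda>\<close> to the right of it, and
  takes a value \<open>x \<in> [0, \<Lambda>]\<close> at \<open>c\<close>.  Its only increments are \<open>x\<close> and \<open>\<Lambda> - x\<close>, so \<open>G\<close> reduces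
  to a two-term function of \<open>x\<close>.

  If \<open>D\<close> exceeds \<open>1\<close> with positive probability, take \<open>c = k - 1\<close>; up to a constant,
  \<open>G\<close> is \<open>- p (\<Lambda> - x)\<^bsup>m+1\<^esup> - q x\<^bsup>m+1\<^esup>\<close> with \<open>p = P(D \<ge> 1)\<close> and \<open>q = P(D \<ge> 2) > 0\<close>.
  If \<open>D\<close> falls below \<open>-1\<close> with positive probability, take \<open>c = k + 1\<close>; now
  \<open>G\<close> is \<open>p x\<^bsup>m+1\<^esup> + q (\<Lambda> - x)\<^bsup>m+1\<^esup>\<close> with \<open>p = P(D < 0)\<close> and \<open>q = P(D < -1) > 0\<close>.
  Since \<open>m \<ge> 1\<close>, the term with weight \<open>p\<close> is flat where its increment vanishes, while the
  term with weight \<open>q\<close> has nonzero slope there.  Hence \<open>G\<close> decreases in \<open>x\<close> close to \<open>x = \<Lambda>\<close> in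
  the first case and close to \<open>x = 0\<close> in the second, no matter how small \<open>\<Lambda>\<close> is.  Both cases
  come down to the inequality \<open>power_transfer_decreases\<close>.
\<close>

text \<open>
  The gain \<open>p h\<^bsup>m+1\<^esup>\<close> is of higher order in \<open>h\<close> than the loss, which is at least \<open>q h \<Lambda>\<^bsup>m\<^esup>\<close>.
\<close>

lemma power_transfer_decreases:
  fixes p q \<Lambda> :: real and m :: nat
  assumes "m \<ge> 1" "0 \<le> p" "p \<le> 1" "0 < q" "q \<le> 1" "0 < \<Lambda>"
  obtains h where "0 < h" "h \<le> \<Lambda>"
    "p * h ^ (m + 1) + q * (\<Lambda> - h) ^ (m + 1) < q * \<Lambda> ^ (m + 1)"
proof
  \<comment> \<open>It suffices that \<open>h\<^bsup>m\<^esup> < q \<Lambda>\<^bsup>m\<^esup>\<close>; as \<open>q / 2 \<le> 1\<close> and \<open>m \<ge> 1\<close>, this choice achieves it.\<close>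
  define h where "h = q / 2 * \<Lambda>"
  show h0: "0 < h" using assms by (simp add: h_def)
  show h1: "h \<le> \<Lambda>" using assms by (simp add: h_def)
  have "(q / 2) ^ m \<le> (q / 2) ^ 1"
    by (rule power_decreasing) (use assms in auto)
  then have "(q / 2) ^ m < q" using assms by simp
  then have "h ^ m < q * \<Lambda> ^ m"
    unfolding h_def power_mult_distrib using assms by (intro mult_strict_right_mono) auto
  then have "h ^ m * h < q * \<Lambda> ^ m * h" using h0 by simp
  moreover have "p * (h ^ m * h) \<le> 1 * (h ^ m * h)"
    using assms h0 by (intro mult_right_mono) auto
  moreover have "(\<Lambda> - h) ^ m * (\<Lambda> - h) \<le> \<Lambda> ^ m * (\<Lambda> - h)"
    using h0 h1 by (intro mult_right_mono power_mono) auto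
  then have "q * ((\<Lambda> - h) ^ m * (\<Lambda> - h)) \<le> q * (\<Lambda> ^ m * (\<Lambda> - h))"
    using assms by (intro mult_left_mono) auto
  ultimately show "p * h ^ (m + 1) + q * (\<Lambda> - h) ^ (m + 1) < q * \<Lambda> ^ (m + 1)"
    by (simp add: algebra_simps)
qed

definition step_profile :: "int set \<Rightarrow> int \<Rightarrow> real \<Rightarrow> real \<Rightarrow> int \<Rightarrow> real" where
  "step_profile I c \<Lambda> x = (\<lambda>j\<in>I. if j < c then 0 else if j = c then x else \<Lambda>)"

lemma step_profile_update:
  assumes "c \<in> I"
  shows "(step_profile I c \<Lambda> y)(c := x) = step_profile I c \<Lambda> x"
  using assms by (auto simp: step_profile_def fun_eq_iff)

lemma step_profile_in_increments_bounded:
  assumes "0 \<le> x" "x \<le> \<Lambda>"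
  shows "step_profile {k - int s..k + int l} c \<Lambda> x \<in> increments_bounded s l k \<Lambda>"
  using assms by (auto simp: step_profile_def increments_bounded_def)

lemma sum_step_profile:
  fixes w :: "int \<Rightarrow> real"
  assumes "{a..b + 1} \<subseteq> I"
  shows "(\<Sum>j\<in>{a..b}. (step_profile I c \<Lambda> x (j + 1) - step_profile I c \<Lambda> x j) ^ (m + 1) * w j) =
         (if c - 1 \<in> {a..b} then x ^ (m + 1) * w (c - 1) else 0)
         + (if c \<in> {a..b} then (\<Lambda> - x) ^ (m + 1) * w c else 0)"
proof -
  have "(\<Sum>j\<in>{a..b}. (step_profile I c \<Lambda> x (j + 1) - step_profile I c \<Lambda> x j) ^ (m + 1) * w j) =
        (\<Sum>j\<in>{a..b}. (if j = c - 1 then x ^ (m + 1) * w (c - 1) else 0)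
                    + (if j = c then (\<Lambda> - x) ^ (m + 1) * w c else 0))"
  proof (rule sum.cong)
    fix j assume "j \<in> {a..b}"
    then have "j \<in> I" "j + 1 \<in> I" using assms by auto
    then show "(step_profile I c \<Lambda> x (j + 1) - step_profile I c \<Lambda> x j) ^ (m + 1) * w j =
        (if j = c - 1 then x ^ (m + 1) * w (c - 1) else 0)
        + (if j = c then (\<Lambda> - x) ^ (m + 1) * w c else 0)"
      by (auto simp: step_profile_def)
  qed simp
  then show ?thesis by (simp only: sum.distrib sum.delta finite_atLeastAtMost_int)
qed

lemma G_step_profile_left:
  assumes "s \<ge> 2"
  shows "G M D m s l k (step_profile {k - int s..k + int l} (k - 1) \<Lambda> x) =
    \<Lambda> - (x ^ (m + 1) * \<P>(\<omega> in M. D \<omega> \<ge> 2) + (\<Lambda> - x) ^ (m + 1) * \<P>(\<omega> in M. D \<omega> \<ge> 1))"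
proof -
  let ?I = "{k - int s..k + int l}"
  have "{k - int s..k - 1 + 1} \<subseteq> ?I" "{k..k + int l - 1 + 1} \<subseteq> ?I" by auto
  moreover have "step_profile ?I (k - 1) \<Lambda> x k = \<Lambda>" by (simp add: step_profile_def)
  moreover have "k - (k - 1 - 1) = 2" "k - (k - 1) = 1" by auto
  ultimately show ?thesis
    unfolding G_def using assms by (simp only: sum_step_profile) auto
qed

lemma G_step_profile_right:
  assumes "l \<ge> 2"
  shows "G M D m s l k (step_profile {k - int s..k + int l} (k + 1) \<Lambda> x) =
    x ^ (m + 1) * \<P>(\<omega> in M. D \<omega> < 0) + (\<Lambda> - x) ^ (m + 1) * \<P>(\<omega> in M. D \<omega> < - 1)"
proof -
  let ?I = "{k - int s..k + int l}"
  have "{k - int s..k - 1 + 1} \<subseteq> ?I" "{k..k + int l - 1 + 1} \<subseteq> ?I" by auto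
  moreover have "step_profile ?I (k + 1) \<Lambda> x k = 0" by (simp add: step_profile_def)
  moreover have "k - (k + 1 - 1) = 0" "k - (k + 1) = - 1" by auto
  ultimately show ?thesis
    unfolding G_def using assms by (simp only: sum_step_profile) auto
qed

lemma nondecreasing_G_step_profile:
  assumes "nondecreasing_in_each_arg_on {k - int s..k + int l}
             (increments_bounded s l k \<Lambda>) (G M D m s l k)"
    and "c \<in> {k - int s..k + int l}" "0 \<le> x" "x \<le> y" "y \<le> \<Lambda>"
  shows "G M D m s l k (step_profile {k - int s..k + int l} c \<Lambda> x)
       \<le> G M D m s l k (step_profile {k - int s..k + int l} c \<Lambda> y)"
proof -
  let ?I = "{k - int s..k + int l}" and ?A = "increments_bounded s l k \<Lambda>"
  let ?f = "step_profile ?I c \<Lambda> x"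
  have mem: "step_profile ?I c \<Lambda> z \<in> ?A" if "z \<in> {x, y}" for z
    using that assms by (intro step_profile_in_increments_bounded) auto
  then have "mono_on {z. ?f(c := z) \<in> ?A} (\<lambda>z. G M D m s l k (?f(c := z)))"
    using assms(1,2) unfolding nondecreasing_in_each_arg_on_def by blast
  from mono_onD[OF this, of x y] mem assms(2,4) show ?thesis
    by (simp add: step_profile_update)
qed

text \<open>
  The two weights act on the terms of the first sum at \<open>j = k - 1\<close> and \<open>j = k - 2\<close>, both of which
  exist because \<open>s \<ge> 2\<close>.  Raising the value at \<open>k - 1\<close> from \<open>\<Lambda> - h\<close> to \<open>\<Lambda>\<close> merges two
  increments into one, which increases the subtracted sum.
\<close>

lemma (in prob_space) not_nondecreasing_G_left:
  assumes "m \<ge> 1" "s \<ge> 2" "\<P>(\<omega> in M. D \<omega> \<ge> 2) > 0" "\<Lambda> > 0"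
  shows "\<not> nondecreasing_in_each_arg_on {k - int s..k + int l}
           (increments_bounded s l k \<Lambda>) (G M D m s l k)"
proof
  assume nd: "nondecreasing_in_each_arg_on {k - int s..k + int l}
    (increments_bounded s l k \<Lambda>) (G M D m s l k)"
  obtain h where h: "0 < h" "h \<le> \<Lambda>"
    "\<P>(\<omega> in M. D \<omega> \<ge> 1) * h ^ (m + 1) + \<P>(\<omega> in M. D \<omega> \<ge> 2) * (\<Lambda> - h) ^ (m + 1)
       < \<P>(\<omega> in M. D \<omega> \<ge> 2) * \<Lambda> ^ (m + 1)"
    by (rule power_transfer_decreases[OF assms(1) measure_nonneg prob_le_1 assms(3) prob_le_1 assms(4)])
  have "G M D m s l k (step_profile {k - int s..k + int l} (k - 1) \<Lambda> (\<Lambda> - h))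
      \<le> G M D m s l k (step_profile {k - int s..k + int l} (k - 1) \<Lambda> \<Lambda>)"
    using nd h(1,2) assms(2) by (intro nondecreasing_G_step_profile) auto
  then show False
    using h(3) by (simp add: G_step_profile_left[OF assms(2)] mult.commute)
qed

text \<open>
  The mirror image: the second sum enters with a plus sign, so it is now splitting the single
  increment \<open>\<Lambda>\<close>, by raising the value at \<open>k + 1\<close> from \<open>0\<close> to \<open>h\<close>, that lowers \<open>G\<close>.
\<close>

lemma (in prob_space) not_nondecreasing_G_right:
  assumes "m \<ge> 1" "l \<ge> 2" "\<P>(\<omega> in M. D \<omega> < - 1) > 0" "\<Lambda> > 0"
  shows "\<not> nondecreasing_in_each_arg_on {k - int s..k + int l}
           (increments_bounded s l k \<Lambda>) (G M D m s l k)"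
proof
  assume nd: "nondecreasing_in_each_arg_on {k - int s..k + int l}
    (increments_bounded s l k \<Lambda>) (G M D m s l k)"
  obtain h where h: "0 < h" "h \<le> \<Lambda>"
    "\<P>(\<omega> in M. D \<omega> < 0) * h ^ (m + 1) + \<P>(\<omega> in M. D \<omega> < - 1) * (\<Lambda> - h) ^ (m + 1)
       < \<P>(\<omega> in M. D \<omega> < - 1) * \<Lambda> ^ (m + 1)"
    by (rule power_transfer_decreases[OF assms(1) measure_nonneg prob_le_1 assms(3) prob_le_1 assms(4)])
  have "G M D m s l k (step_profile {k - int s..k + int l} (k + 1) \<Lambda> 0)
      \<le> G M D m s l k (step_profile {k - int s..k + int l} (k + 1) \<Lambda> h)"
    using nd h(1,2) assms(2) by (intro nondecreasing_G_step_profile) auto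
  then show False
    using h(3) by (simp add: G_step_profile_right[OF assms(2)] mult.commute)
qed

text \<open>
  This turns the almost sure bounds on \<open>D\<close> into the bounds \<open>s \<ge> 2\<close> and \<open>l \<ge> 2\<close>, which make
  room for the increments on both sides of the site \<open>c\<close>.
\<close>

lemma (in prob_space) prob_pos_meets_almost_sure:
  assumes "\<P>(\<omega> in M. Q \<omega>) > 0" "\<P>(\<omega> in M. R \<omega>) = 1"
  obtains \<omega> where "\<omega> \<in> space M" "Q \<omega>" "R \<omega>"
proof -
  \<comment> \<open>Nonmeasurable sets have measure zero by convention, so both sets are events.\<close>
  have ev: "{\<omega> \<in> space M. Q \<omega>} \<in> events" "{\<omega> \<in> space M. R \<omega>} \<in> events"
    using assms measure_notin_sets[of "{\<omega> \<in> space M. Q \<omega>}" M]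
      measure_notin_sets[of "{\<omega> \<in> space M. R \<omega>}" M] by fastforce+
  have "{\<omega> \<in> space M. Q \<omega>} \<inter> {\<omega> \<in> space M. R \<omega>} \<noteq> {}"
  proof
    assume "{\<omega> \<in> space M. Q \<omega>} \<inter> {\<omega> \<in> space M. R \<omega>} = {}"
    from finite_measure_Union[OF ev this] assms
      prob_le_1[of "{\<omega> \<in> space M. Q \<omega>} \<union> {\<omega> \<in> space M. R \<omega>}"]
    show False by simp
  qed
  then show ?thesis using that by blast
qed

theorem theorem5p4:
  fixes M :: "'w measure" and D :: "'w \<Rightarrow> int" and m s l :: nat and k :: int
  assumes "prob_space M"
    and "D \<in> measurable M (count_space UNIV)"
    and "m \<ge> 1"
    and "\<P>(\<omega> in M. - int l \<le> D \<omega> \<and> D \<omega> \<le> int s) = 1"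
    and "\<P>(\<omega> in M. \<bar>D \<omega>\<bar> > 1) > 0"
  shows "\<not> (\<exists>\<Lambda>>0. nondecreasing_in_each_arg_on {k - int s..k + int l}
                    (increments_bounded s l k \<Lambda>) (G M D m s l k))"
proof -
  interpret prob_space M by fact
  note [measurable] = assms(2)
  have "{\<omega> \<in> space M. \<bar>D \<omega>\<bar> > 1} = {\<omega> \<in> space M. D \<omega> \<ge> 2} \<union> {\<omega> \<in> space M. D \<omega> < - 1}"
    by auto
  moreover have "prob ({\<omega> \<in> space M. D \<omega> \<ge> 2} \<union> {\<omega> \<in> space M. D \<omega> < - 1})
      \<le> \<P>(\<omega> in M. D \<omega> \<ge> 2) + \<P>(\<omega> in M. D \<omega> < - 1)"
    by (rule measure_Un_le) measurable
  ultimately have "\<P>(\<omega> in M. D \<omega> \<ge> 2) + \<P>(\<omega> in M. D \<omega> < - 1) > 0"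
    using assms(5) by simp
  then consider "\<P>(\<omega> in M. D \<omega> \<ge> 2) > 0" | "\<P>(\<omega> in M. D \<omega> < - 1) > 0"
    by linarith
  then show ?thesis
  proof cases
    case 1
    then obtain \<omega> where "D \<omega> \<ge> 2" "D \<omega> \<le> int s"
      using prob_pos_meets_almost_sure[OF 1 assms(4)] by blast
    then have "s \<ge> 2" by simp
    with 1 show ?thesis using not_nondecreasing_G_left[OF assms(3)] by blast
  next
    case 2
    then obtain \<omega> where "D \<omega> < - 1" "- int l \<le> D \<omega>"
      using prob_pos_meets_almost_sure[OF 2 assms(4)] by blast
    then have "l \<ge> 2" by simp
    with 2 show ?thesis using not_nondecreasing_G_right[OF assms(3)] by blast
  qed
qed

end
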